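(* Let $A\in\mathbb{R}^{m\times n}$, $b\in\mathbb{R}^m$ and $f:\mathbb{R}^n\to\mathbb{R}$. Assume $f$ is twice differentiable and there are constants $\mu,\ell>0$ with $\mu\|x-y\|^2\le\langle\nabla f(x)-\nabla f(y),x-y\rangle\le\ell\|x-y\|^2$ for all $x,y\in\mathbb{R}^n$. Assume $A$ has full row rank and $\kappa_1 I\preceq AA^T\preceq\kappa_2 I$ for some $\kappa_1,\kappa_2>0$. Let $\eta>0$ and consider the dynamics $$\dot x=-\nabla f(x)-A^T\lambda,\qquad \dot\lambda=\eta(Ax-b),$$ with $(x(t),\lambda(t))\in\mathbb{R}^n\times\mathbb{R}^m$, and let $(x^*,\lambda^* )$ be its equilibrium point. Define $$\tau_{eq}=\min\Big(\frac{\eta\kappa_1}{4\ell},\frac{\kappa_1\mu}{4\kappa_2}\Big).$$ Then for every solution $(x(t),\lambda(t))$, $t\ge 0$, there exist constants $C_1,C_2$, depending only on $\eta,\kappa_1,\kappa_2,\mu,\ell,\|x(0)-x^*\|,\|\lambda(0)-\lambda^*\|$, such that for all $t\ge0$ $$\|x(t)-x^*\|\le C_1e^{-\frac12\tau_{eq}t},\qquad \|\lambda(t)-\lambda^*\|\le C_2e^{-\frac12\tau_{eq}t}.$$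
   Context: $\|\cdot\|$ is the Euclidean norm; $M_1\succeq M_2$ for symmetric matrices means $M_1-M_2$ is positive semidefinite. The dynamics is the primal-dual gradient dynamics $\dot x=-\nabla_xL$, $\dot\lambda=\eta\nabla_\lambda L$ of the Lagrangian $L(x,\lambda)=f(x)+\lambda^T(Ax-b)$ of the problem $\min_x f(x)$ subject to $Ax=b$. Under the stated assumptions the equilibrium point (equivalently, the saddle point of $L$) exists and is unique. *)

theory Defs
  imports Complex_Main "Jordan_Normal_Form.DL_Rank"
begin

text \<open>
  Vectors and matrices are those of Jordan_Normal_Form, whose dimensions are natural numbers
  rather than types.  This lets a single existential quantifier over the constants of a decay
  estimate precede the quantifiers over the dimensions, so that the constants cannot depend on
  them.  These vectors carry no topology, so norm and derivatives are defined here.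
\<close>

definition vnorm :: "real vec \<Rightarrow> real" where
  "vnorm v = sqrt (v \<bullet> v)"

text \<open>Frechet derivative at \<open>x\<close>, represented by the vector \<open>g\<close>; values of \<open>f\<close> outside
  \<open>carrier_vec n\<close> are irrelevant.\<close>

definition has_gradient :: "nat \<Rightarrow> (real vec \<Rightarrow> real) \<Rightarrow> real vec \<Rightarrow> real vec \<Rightarrow> bool" where
  "has_gradient n f g x \<longleftrightarrow> g \<in> carrier_vec n \<and>
     (\<forall>\<epsilon>>0. \<exists>\<delta>>0. \<forall>h\<in>carrier_vec n. vnorm h < \<delta> \<longrightarrow>
        \<bar>f (x + h) - f x - g \<bullet> h\<bar> \<le> \<epsilon> * vnorm h)"

definition gradient :: "nat \<Rightarrow> (real vec \<Rightarrow> real) \<Rightarrow> real vec \<Rightarrow> real vec" where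
  "gradient n f x = (THE g. has_gradient n f g x)"

definition differentiable_vec :: "nat \<Rightarrow> (real vec \<Rightarrow> real) \<Rightarrow> real vec \<Rightarrow> bool" where
  "differentiable_vec n f x \<longleftrightarrow> (\<exists>g. has_gradient n f g x)"

definition twice_differentiable :: "nat \<Rightarrow> (real vec \<Rightarrow> real) \<Rightarrow> bool" where
  "twice_differentiable n f \<longleftrightarrow>
     (\<forall>x\<in>carrier_vec n. differentiable_vec n f x) \<and>
     (\<forall>x\<in>carrier_vec n. \<forall>i<n. differentiable_vec n (\<lambda>y. gradient n f y $ i) x)"

text \<open>The derivative at \<open>t\<close> is taken relative to \<open>[0, \<infinity>)\<close>, hence one-sided at \<open>0\<close>.\<close>

definition curve_has_derivative :: "nat \<Rightarrow> (real \<Rightarrow> real vec) \<Rightarrow> real vec \<Rightarrow> real \<Rightarrow> bool" where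
  "curve_has_derivative n x v t \<longleftrightarrow> v \<in> carrier_vec n \<and>
     (\<forall>i<n. ((\<lambda>s. x s $ i) has_real_derivative v $ i) (at t within {0..}))"

definition psd :: "nat \<Rightarrow> real mat \<Rightarrow> bool" where
  "psd n P \<longleftrightarrow> P \<in> carrier_mat n n \<and> P\<^sup>T = P \<and> (\<forall>v\<in>carrier_vec n. 0 \<le> v \<bullet> (P *\<^sub>v v))"

definition loewner_le :: "nat \<Rightarrow> real mat \<Rightarrow> real mat \<Rightarrow> bool" where
  "loewner_le n P Q \<longleftrightarrow> P \<in> carrier_mat n n \<and> Q \<in> carrier_mat n n \<and> psd n (Q - P)"

definition full_row_rank :: "nat \<Rightarrow> real mat \<Rightarrow> bool" where
  "full_row_rank m A \<longleftrightarrow> vec_space.rank m A = m"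

definition primal_field ::
  "nat \<Rightarrow> (real vec \<Rightarrow> real) \<Rightarrow> real mat \<Rightarrow> real vec \<Rightarrow> real vec \<Rightarrow> real vec" where
  "primal_field n f A x lam = - gradient n f x - A\<^sup>T *\<^sub>v lam"

definition dual_field :: "real \<Rightarrow> real mat \<Rightarrow> real vec \<Rightarrow> real vec \<Rightarrow> real vec" where
  "dual_field \<eta> A b x = \<eta> \<cdot>\<^sub>v (A *\<^sub>v x - b)"

definition is_solution ::
  "nat \<Rightarrow> nat \<Rightarrow> (real vec \<Rightarrow> real) \<Rightarrow> real mat \<Rightarrow> real vec \<Rightarrow> real \<Rightarrow>
   (real \<Rightarrow> real vec) \<Rightarrow> (real \<Rightarrow> real vec) \<Rightarrow> bool" where
  "is_solution n m f A b \<eta> x lam \<longleftrightarrow>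
     (\<forall>t\<ge>0. x t \<in> carrier_vec n \<and> lam t \<in> carrier_vec m \<and>
        curve_has_derivative n x (primal_field n f A (x t) (lam t)) t \<and>
        curve_has_derivative m lam (dual_field \<eta> A b (x t)) t)"

definition is_equilibrium ::
  "nat \<Rightarrow> nat \<Rightarrow> (real vec \<Rightarrow> real) \<Rightarrow> real mat \<Rightarrow> real vec \<Rightarrow> real \<Rightarrow> real vec \<Rightarrow> real vec \<Rightarrow> bool" where
  "is_equilibrium n m f A b \<eta> xs ls \<longleftrightarrow>
     xs \<in> carrier_vec n \<and> ls \<in> carrier_vec m \<and>
     primal_field n f A xs ls = 0\<^sub>v n \<and> dual_field \<eta> A b xs = 0\<^sub>v m"

definition tau_eq :: "real \<Rightarrow> real \<Rightarrow> real \<Rightarrow> real \<Rightarrow> real \<Rightarrow> real" where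
  "tau_eq \<eta> \<kappa>\<^sub>1 \<kappa>\<^sub>2 \<mu> l = min (\<eta> * \<kappa>\<^sub>1 / (4 * l)) (\<kappa>\<^sub>1 * \<mu> / (4 * \<kappa>\<^sub>2))"

text \<open>The gradient is unique, so \<open>gradient\<close> is well defined.\<close>

lemma scalar_prod_self_eq_0:
  fixes v :: "real vec"
  assumes "v \<in> carrier_vec n" and "v \<bullet> v = 0"
  shows "v = 0\<^sub>v n"
proof (rule eq_vecI)
  fix i assume i: "i < dim_vec (0\<^sub>v n :: real vec)"
  have "(\<Sum>i\<in>{0..<n}. v $ i * v $ i) = 0"
    using assms by (simp add: scalar_prod_def)
  hence "\<forall>i\<in>{0..<n}. v $ i * v $ i = 0"
    by (subst (asm) sum_nonneg_eq_0_iff) auto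
  thus "v $ i = 0\<^sub>v n $ i" using i by auto
qed (use assms in auto)

lemma scalar_prod_self_nonneg: "0 \<le> (v :: real vec) \<bullet> v"
  by (auto simp: scalar_prod_def intro!: sum_nonneg)

lemma has_gradient_unique:
  assumes "has_gradient n f g x" and "has_gradient n f g' x"
  shows "g = g'"
proof -
  have c: "g \<in> carrier_vec n" "g' \<in> carrier_vec n"
    using assms by (auto simp: has_gradient_def)
  define d where "d = g - g'"
  have dc: "d \<in> carrier_vec n" using c by (simp add: d_def)
  define N where "N = vnorm d"
  have N2: "d \<bullet> d = N * N" and N0: "N \<ge> 0"
    using scalar_prod_self_nonneg[of d] by (simp_all add: N_def vnorm_def)
  have "N = 0"
  proof (rule ccontr)
    assume "N \<noteq> 0"
    hence Np: "N > 0" using N0 by simp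
    have e: "N / 4 > 0" using Np by simp
    obtain \<delta> where \<delta>: "\<delta> > 0" "\<And>h. h \<in> carrier_vec n \<Longrightarrow> vnorm h < \<delta> \<Longrightarrow>
        \<bar>f (x + h) - f x - g \<bullet> h\<bar> \<le> N / 4 * vnorm h"
      using assms(1) e unfolding has_gradient_def by meson
    obtain \<delta>' where \<delta>': "\<delta>' > 0" "\<And>h. h \<in> carrier_vec n \<Longrightarrow> vnorm h < \<delta>' \<Longrightarrow>
        \<bar>f (x + h) - f x - g' \<bullet> h\<bar> \<le> N / 4 * vnorm h"
      using assms(2) e unfolding has_gradient_def by meson
    define s where "s = min \<delta> \<delta>' / (2 * N)"
    have s: "s > 0" using \<delta>(1) \<delta>'(1) Np by (simp add: s_def)
    define h where "h = s \<cdot>\<^sub>v d"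
    have hc: "h \<in> carrier_vec n" using dc by (simp add: h_def)
    have "h \<bullet> h = (s * N) * (s * N)"
      using dc by (simp add: h_def N2)
    hence nh: "vnorm h = s * N" using s Np by (simp add: vnorm_def)
    have sN: "s * N = min \<delta> \<delta>' / 2" using Np by (simp add: s_def)
    have "vnorm h < \<delta>" "vnorm h < \<delta>'" using nh sN \<delta>(1) \<delta>'(1) by auto
    from \<delta>(2)[OF hc this(1)] \<delta>'(2)[OF hc this(2)]
    have "\<bar>g \<bullet> h - g' \<bullet> h\<bar> \<le> N / 2 * vnorm h" by linarith
    moreover have "g \<bullet> h - g' \<bullet> h = d \<bullet> h"
      using minus_scalar_prod_distrib[OF c hc] by (simp add: d_def)
    moreover have "d \<bullet> h = s * (N * N)" using dc by (simp add: h_def N2)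
    ultimately have "s * (N * N) \<le> N / 2 * (s * N)" unfolding nh by linarith
    also have "N / 2 * (s * N) = s * (N * N) / 2" by simp
    finally have "s * (N * N) \<le> s * (N * N) / 2" .
    moreover have "s * (N * N) > 0" using s Np by simp
    ultimately show False by linarith
  qed
  hence "d = 0\<^sub>v n" using scalar_prod_self_eq_0[OF dc] N2 by simp
  show ?thesis
  proof (rule eq_vecI)
    fix i assume i: "i < dim_vec g'"
    have "d $ i = 0" using \<open>d = 0\<^sub>v n\<close> i c by simp
    thus "g $ i = g' $ i" using i c by (simp add: d_def)
  qed (use c in auto)
qed

lemma gradient_eqI: "has_gradient n f g x \<Longrightarrow> gradient n f x = g"
  unfolding gradient_def by (blast intro: the_equality has_gradient_unique)

lemma differentiable_vec_has_gradient:
  "differentiable_vec n f x \<Longrightarrow> has_gradient n f (gradient n f x) x"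
  unfolding differentiable_vec_def by (auto simp: gradient_eqI)

end

theory Submission
  imports Defs
begin

text \<open>
  Write \<open>d = x - x\<^sup>*\<close>, \<open>e = \<lambda> - \<lambda>\<^sup>*\<close> and \<open>g = \<nabla>f(x) - \<nabla>f(x\<^sup>*)\<close>.  Subtracting the equilibrium
  equations turns the dynamics into \<open>d' = - g - A\<^sup>T e\<close>, \<open>e' = \<eta> A d\<close>.  The weighted error
  \<open>\<eta> |d|\<^sup>2 + |e|\<^sup>2\<close> has derivative \<open>- 2 \<eta> (g \<bullet> d)\<close>, because the two coupling terms cancel.  It never
  increases, but its derivative ignores \<open>e\<close>, so it cannot give a rate.  Adding a small multiple of
  \<open>e \<bullet> A d\<close> repairs this: differentiating that term produces \<open>- |A\<^sup>T e|\<^sup>2\<close>, which controls \<open>|e|\<^sup>2\<close>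
  since \<open>A A\<^sup>T\<close> is bounded below by \<open>\<kappa>\<^sub>1\<close>.  This is the function
  \<open>V = \<eta> c |d|\<^sup>2 + 2 \<eta> (e \<bullet> A d) + c |e|\<^sup>2\<close>.

  The new term also produces the unwanted \<open>g \<bullet> A\<^sup>T e\<close> and \<open>|A d|\<^sup>2\<close>.  Completing a square trades
  the former for \<open>|g|\<^sup>2\<close>, and both are then absorbed by \<open>- 2 c (g \<bullet> d)\<close> when \<open>c\<close> is large.
  For \<open>|A d|\<^sup>2\<close> this uses strong monotonicity and the bound \<open>\<kappa>\<^sub>2\<close>; for \<open>|g|\<^sup>2\<close> it uses
  cocoercivity, \<open>|g|\<^sup>2 \<le> l (g \<bullet> d)\<close> (\<open>gradient_cocoercive\<close>).  Cocoercivity follows by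
  comparing \<open>f\<close> along line segments with its tangents and with a quadratic majorant.

  With \<open>c = \<eta> \<kappa>\<^sub>1 / \<tau> = 4 max(l, \<eta> \<kappa>\<^sub>2 / \<mu>)\<close> everything closes and gives \<open>V' \<le> - \<tau> V\<close>
  (\<open>lyapunov_dissipation\<close>).  The same \<open>c\<close> is large enough for the cross term to change
  \<open>c (\<eta> |d|\<^sup>2 + |e|\<^sup>2)\<close> by at most a quarter (\<open>lyapunov_equivalent_norm\<close>).  Hence
  \<open>\<eta> |d|\<^sup>2 + |e|\<^sup>2\<close> decays like \<open>exp (- \<tau> t)\<close> up to the factor \<open>(5/4) / (3/4) = 5/3\<close>, and taking
  square roots halves the rate.
\<close>

section \<open>Euclidean geometry of coordinate vectors\<close>

lemma vnorm_nonneg: "0 \<le> vnorm v"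
  by (simp add: vnorm_def scalar_prod_self_nonneg)

lemma power2_vnorm: "(vnorm v)\<^sup>2 = v \<bullet> v"
  by (simp add: vnorm_def scalar_prod_self_nonneg)

lemma vnorm_smult:
  assumes "v \<in> carrier_vec n"
  shows "vnorm (s \<cdot>\<^sub>v v) = \<bar>s\<bar> * vnorm v"
proof -
  have "(s \<cdot>\<^sub>v v) \<bullet> (s \<cdot>\<^sub>v v) = s\<^sup>2 * (v \<bullet> v)"
    using assms by (simp add: power2_eq_square)
  then show ?thesis by (simp add: vnorm_def real_sqrt_mult)
qed

lemma scalar_prod_self_diff:
  fixes u v :: "real vec"
  assumes "u \<in> carrier_vec n" "v \<in> carrier_vec n"
  shows "(u - v) \<bullet> (u - v) = u \<bullet> u - 2 * (u \<bullet> v) + v \<bullet> v"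
  using assms comm_scalar_prod[of v n u]
  by (simp add: minus_scalar_prod_distrib[where n = n] scalar_prod_minus_distrib[where n = n])

text \<open>Young's inequality: the square \<open>|u - s v|\<^sup>2\<close> is nonnegative.\<close>
lemma two_scalar_prod_le:
  fixes u v :: "real vec"
  assumes "u \<in> carrier_vec n" "v \<in> carrier_vec n"
  shows "2 * s * (u \<bullet> v) \<le> u \<bullet> u + s\<^sup>2 * (v \<bullet> v)"
  using scalar_prod_self_nonneg[of "u - s \<cdot>\<^sub>v v"] assms
  by (simp add: scalar_prod_self_diff[where n = n] power2_eq_square)

section \<open>Spectral bounds on the constraint matrix\<close>

lemma scalar_prod_gram:
  fixes A :: "real mat"
  assumes "A \<in> carrier_mat m n" "v \<in> carrier_vec m"
  shows "v \<bullet> ((A * A\<^sup>T) *\<^sub>v v) = (A\<^sup>T *\<^sub>v v) \<bullet> (A\<^sup>T *\<^sub>v v)"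
proof -
  have "v \<bullet> ((A * A\<^sup>T) *\<^sub>v v) = v \<bullet> (A *\<^sub>v (A\<^sup>T *\<^sub>v v))"
    using assms by simp
  also have "\<dots> = (A *\<^sub>v (A\<^sup>T *\<^sub>v v)) \<bullet> v"
    using assms by (intro comm_scalar_prod[where n = m]) auto
  also have "\<dots> = (A\<^sup>T *\<^sub>v v) \<bullet> (A\<^sup>T *\<^sub>v v)"
    using assms transpose_vec_mult_scalar[of A m n "A\<^sup>T *\<^sub>v v" v]
    using comm_scalar_prod by (metis mult_mat_vec_carrier transpose_carrier_mat)
  finally show ?thesis .
qed

lemma scalar_prod_smult_one_mat:
  fixes v :: "real vec"
  assumes "v \<in> carrier_vec m"
  shows "v \<bullet> ((k \<cdot>\<^sub>m 1\<^sub>m m) *\<^sub>v v) = k * (v \<bullet> v)"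
proof -
  have "(k \<cdot>\<^sub>m 1\<^sub>m m) *\<^sub>v v = k \<cdot>\<^sub>v v"
    using assms by (intro eq_vecI) auto
  then show ?thesis using assms by simp
qed

text \<open>The quadratic form of \<open>A A\<^sup>T\<close> at \<open>v\<close> is \<open>|A\<^sup>T v|\<^sup>2\<close>, so this lets the dissipation term
  \<open>|A\<^sup>T e|\<^sup>2\<close> control the full dual error \<open>|e|\<^sup>2\<close>.\<close>
lemma gram_lower_bound:
  assumes "A \<in> carrier_mat m n" "loewner_le m (k \<cdot>\<^sub>m 1\<^sub>m m) (A * A\<^sup>T)" "v \<in> carrier_vec m"
  shows "k * (v \<bullet> v) \<le> (A\<^sup>T *\<^sub>v v) \<bullet> (A\<^sup>T *\<^sub>v v)"
proof -
  have AA: "A * A\<^sup>T \<in> carrier_mat m m" using assms(1) by simp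
  have "0 \<le> v \<bullet> ((A * A\<^sup>T - k \<cdot>\<^sub>m 1\<^sub>m m) *\<^sub>v v)"
    using assms by (simp add: loewner_le_def psd_def)
  also have "\<dots> = v \<bullet> ((A * A\<^sup>T) *\<^sub>v v) - v \<bullet> ((k \<cdot>\<^sub>m 1\<^sub>m m) *\<^sub>v v)"
    unfolding minus_mult_distrib_mat_vec[OF AA smult_carrier_mat[OF one_carrier_mat] assms(3)]
    using AA assms by (intro scalar_prod_minus_distrib[where n = m] mult_mat_vec_carrier) auto
  finally show ?thesis
    using assms by (simp only: scalar_prod_gram scalar_prod_smult_one_mat)
qed

lemma gram_upper_bound:
  assumes "A \<in> carrier_mat m n" "loewner_le m (A * A\<^sup>T) (k \<cdot>\<^sub>m 1\<^sub>m m)" "v \<in> carrier_vec m"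
  shows "(A\<^sup>T *\<^sub>v v) \<bullet> (A\<^sup>T *\<^sub>v v) \<le> k * (v \<bullet> v)"
proof -
  have AA: "A * A\<^sup>T \<in> carrier_mat m m" using assms(1) by simp
  have "0 \<le> v \<bullet> ((k \<cdot>\<^sub>m 1\<^sub>m m - A * A\<^sup>T) *\<^sub>v v)"
    using assms by (simp add: loewner_le_def psd_def)
  also have "\<dots> = v \<bullet> ((k \<cdot>\<^sub>m 1\<^sub>m m) *\<^sub>v v) - v \<bullet> ((A * A\<^sup>T) *\<^sub>v v)"
    unfolding minus_mult_distrib_mat_vec[OF smult_carrier_mat[OF one_carrier_mat] AA assms(3)]
    using AA assms by (intro scalar_prod_minus_distrib[where n = m] mult_mat_vec_carrier) auto
  finally show ?thesis
    using assms by (simp only: scalar_prod_gram scalar_prod_smult_one_mat)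
qed

text \<open>\<open>A\<close> and \<open>A\<^sup>T\<close> have the same operator norm.  With \<open>u = A v\<close>, expanding \<open>|A\<^sup>T u - k v|\<^sup>2 \<ge> 0\<close> and
  using \<open>A\<^sup>T u \<bullet> v = |u|\<^sup>2\<close> reduces the claim to the bound on \<open>|A\<^sup>T u|\<^sup>2\<close>.\<close>
lemma image_norm_bound:
  assumes A: "A \<in> carrier_mat m n" and le: "loewner_le m (A * A\<^sup>T) (k \<cdot>\<^sub>m 1\<^sub>m m)" and "0 < k"
    and v: "v \<in> carrier_vec n"
  shows "(A *\<^sub>v v) \<bullet> (A *\<^sub>v v) \<le> k * (v \<bullet> v)"
proof -
  let ?u = "A *\<^sub>v v"
  have u: "?u \<in> carrier_vec m" "A\<^sup>T *\<^sub>v ?u \<in> carrier_vec n" using A v by auto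
  have "(A\<^sup>T *\<^sub>v ?u) \<bullet> v = ?u \<bullet> ?u"
    using transpose_vec_mult_scalar[OF A v u(1)] .
  then have "2 * k * (?u \<bullet> ?u) \<le> (A\<^sup>T *\<^sub>v ?u) \<bullet> (A\<^sup>T *\<^sub>v ?u) + k\<^sup>2 * (v \<bullet> v)"
    using two_scalar_prod_le[OF u(2) v, of k] by simp
  also have "\<dots> \<le> k * (?u \<bullet> ?u) + k\<^sup>2 * (v \<bullet> v)"
    using gram_upper_bound[OF A le u(1)] by simp
  finally have "k * (?u \<bullet> ?u) \<le> k * (k * (v \<bullet> v))"
    by (simp add: power2_eq_square)
  then show ?thesis using \<open>0 < k\<close> by simp
qed

section \<open>Convex functions whose gradient obeys a one-sided Lipschitz bound\<close>

lemma has_real_derivative_along_line: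
  assumes grad: "has_gradient n f g (y + s \<cdot>\<^sub>v h)"
    and y: "y \<in> carrier_vec n" and h: "h \<in> carrier_vec n"
  shows "((\<lambda>s. f (y + s \<cdot>\<^sub>v h)) has_real_derivative g \<bullet> h) (at s)"
  unfolding DERIV_def
proof (rule LIM_I)
  fix r :: real assume "0 < r"
  have pos: "0 < vnorm h + 1" using vnorm_nonneg[of h] by simp
  have g: "g \<in> carrier_vec n" using grad by (simp add: has_gradient_def)
  obtain \<delta> where "0 < \<delta>" and \<delta>: "\<And>k. k \<in> carrier_vec n \<Longrightarrow> vnorm k < \<delta> \<Longrightarrow>
      \<bar>f (y + s \<cdot>\<^sub>v h + k) - f (y + s \<cdot>\<^sub>v h) - g \<bullet> k\<bar> \<le> r / (vnorm h + 1) * vnorm k"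
    using grad \<open>0 < r\<close> pos unfolding has_gradient_def by (meson divide_pos_pos)
  show "\<exists>d>0. \<forall>t. t \<noteq> 0 \<and> norm (t - 0) < d \<longrightarrow>
      norm ((f (y + (s + t) \<cdot>\<^sub>v h) - f (y + s \<cdot>\<^sub>v h)) / t - g \<bullet> h) < r"
  proof (intro exI[of _ "\<delta> / (vnorm h + 1)"] conjI allI impI)
    show "0 < \<delta> / (vnorm h + 1)" using \<open>0 < \<delta>\<close> pos by simp
    fix t :: real assume t: "t \<noteq> 0 \<and> norm (t - 0) < \<delta> / (vnorm h + 1)"
    have "\<bar>t\<bar> * vnorm h \<le> \<bar>t\<bar> * (vnorm h + 1)" by (simp add: mult_left_mono)
    also have "\<dots> < \<delta>" using t pos by (simp add: field_simps)
    finally have "vnorm (t \<cdot>\<^sub>v h) < \<delta>" using h by (simp add: vnorm_smult)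
    moreover have "y + (s + t) \<cdot>\<^sub>v h = y + s \<cdot>\<^sub>v h + t \<cdot>\<^sub>v h"
      using y h by (intro eq_vecI) (auto simp: algebra_simps)
    ultimately have "\<bar>f (y + (s + t) \<cdot>\<^sub>v h) - f (y + s \<cdot>\<^sub>v h) - t * (g \<bullet> h)\<bar>
        \<le> r / (vnorm h + 1) * (\<bar>t\<bar> * vnorm h)"
      using \<delta>[of "t \<cdot>\<^sub>v h"] h g by (simp add: vnorm_smult)
    also have "\<dots> = \<bar>t\<bar> * (r * vnorm h / (vnorm h + 1))" by simp
    also have "\<dots> < \<bar>t\<bar> * r"
      using t pos \<open>0 < r\<close> by (intro mult_strict_left_mono) (auto simp: field_simps)
    finally have "\<bar>f (y + (s + t) \<cdot>\<^sub>v h) - f (y + s \<cdot>\<^sub>v h) - t * (g \<bullet> h)\<bar> / \<bar>t\<bar> < r"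
      using t by (simp add: field_simps)
    moreover have "(f (y + (s + t) \<cdot>\<^sub>v h) - f (y + s \<cdot>\<^sub>v h)) / t - g \<bullet> h
        = (f (y + (s + t) \<cdot>\<^sub>v h) - f (y + s \<cdot>\<^sub>v h) - t * (g \<bullet> h)) / t"
      using t by (simp add: field_simps)
    ultimately show "norm ((f (y + (s + t) \<cdot>\<^sub>v h) - f (y + s \<cdot>\<^sub>v h)) / t - g \<bullet> h) < r"
      by (simp add: abs_divide)
  qed
qed

lemma gradient_carrier:
  assumes "differentiable_vec n f y"
  shows "gradient n f y \<in> carrier_vec n"
  using differentiable_vec_has_gradient[OF assms] by (simp add: has_gradient_def)

text \<open>Subtracting \<open>k s\<^sup>2 |h|\<^sup>2 / 2\<close> from \<open>\<sigma>\<close> times the remainder at \<open>y + s h\<close> gives a function of \<open>s\<close>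
  with nonpositive derivative on \<open>[0, 1]\<close>.  The sign \<open>\<sigma>\<close> serves two uses: \<open>\<sigma> = 1\<close>, \<open>k = l\<close> is the
  descent lemma, and \<open>\<sigma> = - 1\<close>, \<open>k = 0\<close> says that a function with monotone gradient lies above
  its tangents.\<close>
lemma first_order_remainder_bound:
  assumes diff: "\<And>y. y \<in> carrier_vec n \<Longrightarrow> differentiable_vec n f y"
    and bound: "\<And>y z. y \<in> carrier_vec n \<Longrightarrow> z \<in> carrier_vec n \<Longrightarrow>
      \<sigma> * ((gradient n f y - gradient n f z) \<bullet> (y - z)) \<le> k * (vnorm (y - z))\<^sup>2"
    and y: "y \<in> carrier_vec n" and h: "h \<in> carrier_vec n"
  shows "\<sigma> * (f (y + h) - f y - gradient n f y \<bullet> h) \<le> k / 2 * (h \<bullet> h)"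
proof -
  let ?G = "gradient n f"
  let ?\<psi> = "\<lambda>s. \<sigma> * (f (y + s \<cdot>\<^sub>v h) - s * (?G y \<bullet> h)) - k / 2 * s\<^sup>2 * (h \<bullet> h)"
  have y0: "y + 0 \<cdot>\<^sub>v h = y" using y h by (intro eq_vecI) auto
  have "?\<psi> 1 \<le> ?\<psi> 0"
  proof (rule DERIV_nonpos_imp_nonincreasing[of 0 1])
    fix s :: real assume s: "0 \<le> s" "s \<le> 1"
    have ys: "y + s \<cdot>\<^sub>v h \<in> carrier_vec n" using y h by simp
    have c: "?G (y + s \<cdot>\<^sub>v h) \<in> carrier_vec n" "?G y \<in> carrier_vec n"
      using gradient_carrier diff ys y by auto
    have "((\<lambda>s. f (y + s \<cdot>\<^sub>v h)) has_real_derivative ?G (y + s \<cdot>\<^sub>v h) \<bullet> h) (at s)"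
      using has_real_derivative_along_line differentiable_vec_has_gradient diff ys y h by blast
    then have D: "(?\<psi> has_real_derivative
        \<sigma> * (?G (y + s \<cdot>\<^sub>v h) \<bullet> h - ?G y \<bullet> h) - k * s * (h \<bullet> h)) (at s)"
      by (auto intro!: derivative_eq_intros)
    have "\<sigma> * (?G (y + s \<cdot>\<^sub>v h) \<bullet> h - ?G y \<bullet> h) - k * s * (h \<bullet> h) \<le> 0"
    proof (cases "s = 0")
      case True
      then show ?thesis by (simp add: y0)
    next
      case False
      have step: "y + s \<cdot>\<^sub>v h - y = s \<cdot>\<^sub>v h" using y h by (intro eq_vecI) auto
      have "(?G (y + s \<cdot>\<^sub>v h) - ?G y) \<bullet> (s \<cdot>\<^sub>v h) = s * (?G (y + s \<cdot>\<^sub>v h) \<bullet> h - ?G y \<bullet> h)"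
        using c h by (simp add: minus_scalar_prod_distrib[where n = n] algebra_simps)
      then have "s * (\<sigma> * (?G (y + s \<cdot>\<^sub>v h) \<bullet> h - ?G y \<bullet> h)) \<le> s * (k * s * (h \<bullet> h))"
        using bound[OF ys y] h unfolding step
        by (simp only: power2_vnorm) (simp add: mult.left_commute mult.assoc)
      then show ?thesis using False s by simp
    qed
    with D show "\<exists>D. DERIV ?\<psi> s :> D \<and> D \<le> 0" by blast
  qed simp
  moreover have "1 \<cdot>\<^sub>v h = h" using h by auto
  ultimately show ?thesis by (simp add: y0 algebra_simps)
qed

text \<open>Compare two estimates of \<open>f\<close> at the point reached from \<open>y\<close> by a gradient step of length \<open>1 / l\<close>
  for the function \<open>v \<mapsto> f(v) - \<nabla>f(z) \<bullet> v\<close>, which is minimal at \<open>z\<close>: the tangent at \<open>z\<close> bounds it below, the descent lemma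
  at \<open>y\<close> above.\<close>
lemma bregman_lower_bound:
  assumes diff: "\<And>y. y \<in> carrier_vec n \<Longrightarrow> differentiable_vec n f y"
    and mono: "\<And>y z. y \<in> carrier_vec n \<Longrightarrow> z \<in> carrier_vec n \<Longrightarrow>
      0 \<le> (gradient n f y - gradient n f z) \<bullet> (y - z)"
    and upper: "\<And>y z. y \<in> carrier_vec n \<Longrightarrow> z \<in> carrier_vec n \<Longrightarrow>
      (gradient n f y - gradient n f z) \<bullet> (y - z) \<le> l * (vnorm (y - z))\<^sup>2"
    and "0 < l" and y: "y \<in> carrier_vec n" and z: "z \<in> carrier_vec n"
  shows "(vnorm (gradient n f y - gradient n f z))\<^sup>2 / (2 * l)
    \<le> f y - f z - gradient n f z \<bullet> (y - z)"
proof -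
  let ?G = "gradient n f"
  define g where "g = ?G y - ?G z"
  have c: "?G y \<in> carrier_vec n" "?G z \<in> carrier_vec n" "g \<in> carrier_vec n"
    using gradient_carrier diff y z by (auto simp: g_def)
  define h where "h = (- 1 / l) \<cdot>\<^sub>v g"
  have h: "h \<in> carrier_vec n" using c by (simp add: h_def)
  have "z + ((y - z) + h) = y + h"
    using y z h by (intro eq_vecI) auto
  then have "f z + ?G z \<bullet> ((y - z) + h) \<le> f (y + h)"
    using first_order_remainder_bound[OF diff _ z, of "- 1" 0 "(y - z) + h"] mono y z h by simp
  also have "\<dots> \<le> f y + ?G y \<bullet> h + l / 2 * (h \<bullet> h)"
    using first_order_remainder_bound[OF diff _ y h, of 1 l] upper by simp
  finally have "f z + ?G z \<bullet> (y - z) + ?G z \<bullet> h \<le> f y + ?G y \<bullet> h + l / 2 * (h \<bullet> h)"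
    using scalar_prod_add_distrib[OF c(2) minus_carrier_vec[OF y z] h] by simp
  moreover have "?G y \<bullet> h - ?G z \<bullet> h = g \<bullet> h"
    using minus_scalar_prod_distrib[OF c(1,2) h] by (simp add: g_def)
  moreover have "g \<bullet> h = - (g \<bullet> g) / l" "h \<bullet> h = (g \<bullet> g) / l\<^sup>2"
    using c by (simp_all add: h_def power2_eq_square)
  moreover have "(g \<bullet> g) / (2 * l) = (g \<bullet> g) / l - l / 2 * ((g \<bullet> g) / l\<^sup>2)"
    using \<open>0 < l\<close> by (simp add: field_simps power2_eq_square)
  ultimately have "(g \<bullet> g) / (2 * l) \<le> f y - f z - ?G z \<bullet> (y - z)"
    by (simp add: minus_divide_left[symmetric])
  then show ?thesis by (simp add: g_def power2_vnorm)
qed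

text \<open>Adding the Bregman bound for \<open>(y, z)\<close> to the one for \<open>(z, y)\<close> cancels the function values.\<close>
lemma gradient_cocoercive:
  assumes diff: "\<And>y. y \<in> carrier_vec n \<Longrightarrow> differentiable_vec n f y"
    and mono: "\<And>y z. y \<in> carrier_vec n \<Longrightarrow> z \<in> carrier_vec n \<Longrightarrow>
      0 \<le> (gradient n f y - gradient n f z) \<bullet> (y - z)"
    and upper: "\<And>y z. y \<in> carrier_vec n \<Longrightarrow> z \<in> carrier_vec n \<Longrightarrow>
      (gradient n f y - gradient n f z) \<bullet> (y - z) \<le> l * (vnorm (y - z))\<^sup>2"
    and "0 < l" and y: "y \<in> carrier_vec n" and z: "z \<in> carrier_vec n"
  shows "(vnorm (gradient n f y - gradient n f z))\<^sup>2
    \<le> l * ((gradient n f y - gradient n f z) \<bullet> (y - z))"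
proof -
  let ?G = "gradient n f"
  have c: "?G y \<in> carrier_vec n" "?G z \<in> carrier_vec n"
    using gradient_carrier diff y z by auto
  have "(?G z - ?G y) \<bullet> (?G z - ?G y) = (?G y - ?G z) \<bullet> (?G y - ?G z)"
    using c comm_scalar_prod[OF c] by (simp add: scalar_prod_self_diff)
  then have sym: "(vnorm (?G z - ?G y))\<^sup>2 = (vnorm (?G y - ?G z))\<^sup>2"
    by (simp add: power2_vnorm)
  have "?G z \<bullet> (y - z) = ?G z \<bullet> y - ?G z \<bullet> z" "?G y \<bullet> (z - y) = ?G y \<bullet> z - ?G y \<bullet> y"
    "(?G y - ?G z) \<bullet> (y - z) = ?G y \<bullet> y - ?G y \<bullet> z - (?G z \<bullet> y - ?G z \<bullet> z)"
    using c y z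
    by (simp_all add: scalar_prod_minus_distrib[where n = n] minus_scalar_prod_distrib[where n = n])
  then have "(vnorm (?G y - ?G z))\<^sup>2 / (2 * l) + (vnorm (?G y - ?G z))\<^sup>2 / (2 * l)
      \<le> (?G y - ?G z) \<bullet> (y - z)"
    using bregman_lower_bound[OF diff mono upper \<open>0 < l\<close> y z]
      bregman_lower_bound[OF diff mono upper \<open>0 < l\<close> z y] unfolding sym by linarith
  then show ?thesis using \<open>0 < l\<close> by (simp add: field_simps)
qed


section \<open>Calculus of curves\<close>

lemma has_derivative_scalar_prod:
  assumes u: "curve_has_derivative n u u' t" and v: "curve_has_derivative n v v' t"
    and cu: "\<And>s. 0 \<le> s \<Longrightarrow> u s \<in> carrier_vec n" and cv: "\<And>s. 0 \<le> s \<Longrightarrow> v s \<in> carrier_vec n"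
    and "0 \<le> t"
  shows "((\<lambda>s. u s \<bullet> v s) has_real_derivative u' \<bullet> v t + u t \<bullet> v') (at t within {0..})"
proof (rule has_field_derivative_transform_within[where d = 1])
  have c: "u' \<in> carrier_vec n" "v' \<in> carrier_vec n" "u t \<in> carrier_vec n" "v t \<in> carrier_vec n"
    using u v cu cv \<open>0 \<le> t\<close> by (auto simp: curve_has_derivative_def)
  have "((\<lambda>s. \<Sum>i = 0..<n. u s $ i * v s $ i) has_real_derivative
      (\<Sum>i = 0..<n. u' $ i * v t $ i + v' $ i * u t $ i)) (at t within {0..})"
    using u v by (intro DERIV_sum DERIV_mult) (auto simp: curve_has_derivative_def)
  moreover have "(\<Sum>i = 0..<n. u' $ i * v t $ i + v' $ i * u t $ i) = u' \<bullet> v t + u t \<bullet> v'"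
    using c by (simp add: scalar_prod_def sum.distrib mult.commute)
  ultimately show "((\<lambda>s. \<Sum>i = 0..<n. u s $ i * v s $ i) has_real_derivative
      u' \<bullet> v t + u t \<bullet> v') (at t within {0..})" by simp
  show "(\<Sum>i = 0..<n. u s $ i * v s $ i) = u s \<bullet> v s" if "s \<in> {0..}" for s
    using carrier_vecD[OF cv[of s]] that by (simp add: scalar_prod_def)
qed (use \<open>0 \<le> t\<close> in simp_all)

lemma curve_has_derivative_const:
  "curve_has_derivative n (\<lambda>s. a) (0\<^sub>v n) t"
  by (simp add: curve_has_derivative_def)

lemma curve_has_derivative_diff_const:
  assumes "curve_has_derivative n u u' t" "a \<in> carrier_vec n"
  shows "curve_has_derivative n (\<lambda>s. u s - a) u' t"
  using assms by (auto simp: curve_has_derivative_def intro!: derivative_eq_intros)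

lemma curve_has_derivative_mult_mat_vec:
  assumes u: "curve_has_derivative n u u' t"
    and cu: "\<And>s. 0 \<le> s \<Longrightarrow> u s \<in> carrier_vec n" and "0 \<le> t" and A: "A \<in> carrier_mat m n"
  shows "curve_has_derivative m (\<lambda>s. A *\<^sub>v u s) (A *\<^sub>v u') t"
proof -
  have u': "u' \<in> carrier_vec n" using u by (simp add: curve_has_derivative_def)
  have "((\<lambda>s. (A *\<^sub>v u s) $ i) has_real_derivative (A *\<^sub>v u') $ i) (at t within {0..})"
    if "i < m" for i
  proof -
    have row: "row A i \<in> carrier_vec n" using A by auto
    have "((\<lambda>s. row A i \<bullet> u s) has_real_derivative 0\<^sub>v n \<bullet> u t + row A i \<bullet> u')
        (at t within {0..})"
      using has_derivative_scalar_prod[OF curve_has_derivative_const u row cu \<open>0 \<le> t\<close>] .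
    then show ?thesis using that A cu[OF \<open>0 \<le> t\<close>] by simp
  qed
  then show ?thesis using A u' by (simp add: curve_has_derivative_def)
qed

text \<open>The function \<open>exp (\<tau> t) V(t)\<close> is nonincreasing.  The mean value theorem needs two-sided
  derivatives only in the interior of \<open>[0, t]\<close>, so the one-sided derivative at \<open>0\<close> is used for
  continuity alone.\<close>
lemma exponential_decay:
  assumes deriv: "\<And>t. 0 \<le> t \<Longrightarrow> (V has_real_derivative V' t) (at t within {0..})"
    and diss: "\<And>t. 0 \<le> t \<Longrightarrow> V' t + \<tau> * V t \<le> 0" and "0 \<le> t"
  shows "V t \<le> V 0 * exp (- \<tau> * t)"
proof -
  let ?F = "\<lambda>s. exp (\<tau> * s) * V s"
  have D: "(?F has_real_derivative exp (\<tau> * s) * (V' s + \<tau> * V s)) (at s within {0..})"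
    if "0 \<le> s" for s
    using deriv[OF that] by (auto intro!: derivative_eq_intros simp: algebra_simps)
  have "?F t \<le> ?F 0"
  proof (rule DERIV_nonpos_imp_decreasing_open[OF \<open>0 \<le> t\<close>])
    fix s assume s: "0 < s" "s < t"
    have "at s within {0..} = at s"
      using s by (intro at_within_open_subset[of _ "{0<..}"]) auto
    moreover have "exp (\<tau> * s) * (V' s + \<tau> * V s) \<le> 0"
      using diss[of s] s by (intro mult_nonneg_nonpos) auto
    ultimately show "\<exists>D. DERIV ?F s :> D \<and> D \<le> 0" using D[of s] s by auto
  next
    have "continuous_on {0..} ?F" using D by (intro DERIV_continuous_on) auto
    then show "continuous_on {0..t} ?F" by (rule continuous_on_subset) auto
  qed
  then have "exp (- \<tau> * t) * (exp (\<tau> * t) * V t) \<le> exp (- \<tau> * t) * V 0"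
    by (intro mult_left_mono) auto
  moreover have "exp (- \<tau> * t) * (exp (\<tau> * t) * V t) = V t" by (simp add: exp_minus)
  ultimately have "V t \<le> exp (- \<tau> * t) * V 0"
    by (simp only: mult_zero_right exp_zero mult_1)
  then show ?thesis by (simp only: mult.commute)
qed

section \<open>The Lyapunov function with a cross term\<close>

text \<open>The quadratic form of the block matrix with rows \<open>(\<eta> c I, \<eta> A\<^sup>T)\<close> and \<open>(\<eta> A, c I)\<close>.\<close>
definition lyapunov :: "real \<Rightarrow> real \<Rightarrow> real mat \<Rightarrow> real vec \<Rightarrow> real vec \<Rightarrow> real" where
  "lyapunov \<eta> c A d e = \<eta> * c * (d \<bullet> d) + 2 * \<eta> * (e \<bullet> (A *\<^sub>v d)) + c * (e \<bullet> e)"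

text \<open>For positive parameters this is \<open>4 max(l, \<eta> \<kappa>\<^sub>2 / \<mu>)\<close>.  It is defined through \<open>\<tau>\<close> because the decay estimate needs
  \<open>\<tau> c = \<eta> \<kappa>\<^sub>1\<close> exactly: then \<open>\<tau> c |e|\<^sup>2\<close> uses up one of the two available copies of
  \<open>\<eta> |A\<^sup>T e|\<^sup>2\<close>.\<close>
definition lyapunov_weight :: "real \<Rightarrow> real \<Rightarrow> real \<Rightarrow> real \<Rightarrow> real \<Rightarrow> real" where
  "lyapunov_weight \<eta> \<kappa>\<^sub>1 \<kappa>\<^sub>2 \<mu> l = \<eta> * \<kappa>\<^sub>1 / tau_eq \<eta> \<kappa>\<^sub>1 \<kappa>\<^sub>2 \<mu> l"

lemma tau_eq_pos:
  assumes "0 < \<eta>" "0 < \<kappa>\<^sub>1" "0 < \<kappa>\<^sub>2" "0 < \<mu>" "0 < l"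
  shows "0 < tau_eq \<eta> \<kappa>\<^sub>1 \<kappa>\<^sub>2 \<mu> l"
  using assms by (simp add: tau_eq_def)

lemma lyapunov_weight_bounds:
  assumes pos: "0 < \<eta>" "0 < \<kappa>\<^sub>1" "0 < \<kappa>\<^sub>2" "0 < \<mu>" "0 < l"
  shows "4 * l \<le> lyapunov_weight \<eta> \<kappa>\<^sub>1 \<kappa>\<^sub>2 \<mu> l"
    and "4 * \<eta> * \<kappa>\<^sub>2 \<le> lyapunov_weight \<eta> \<kappa>\<^sub>1 \<kappa>\<^sub>2 \<mu> l * \<mu>"
proof -
  let ?t = "tau_eq \<eta> \<kappa>\<^sub>1 \<kappa>\<^sub>2 \<mu> l"
  have t: "0 < ?t" using tau_eq_pos[OF pos] .
  have "?t \<le> \<eta> * \<kappa>\<^sub>1 / (4 * l)" "?t \<le> \<kappa>\<^sub>1 * \<mu> / (4 * \<kappa>\<^sub>2)" by (simp_all add: tau_eq_def)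
  then have l: "4 * l * ?t \<le> \<eta> * \<kappa>\<^sub>1" and k: "4 * \<kappa>\<^sub>2 * ?t \<le> \<kappa>\<^sub>1 * \<mu>"
    using pos by (simp_all add: field_simps)
  show "4 * l \<le> lyapunov_weight \<eta> \<kappa>\<^sub>1 \<kappa>\<^sub>2 \<mu> l"
    using l t by (simp add: lyapunov_weight_def pos_le_divide_eq)
  show "4 * \<eta> * \<kappa>\<^sub>2 \<le> lyapunov_weight \<eta> \<kappa>\<^sub>1 \<kappa>\<^sub>2 \<mu> l * \<mu>"
    using mult_left_mono[OF k, of \<eta>] pos t by (simp add: lyapunov_weight_def field_simps)
qed

text \<open>The cross term \<open>2 \<eta> (e \<bullet> A d)\<close> is split by Young's inequality with the weight \<open>c / (4 \<eta>)\<close>, the one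
  that leaves exactly \<open>c / 4\<close> in front of \<open>|e|\<^sup>2\<close>.  The hypothesis on \<open>c\<^sup>2\<close> then puts at most
  \<open>\<eta> c / 4\<close> in front of \<open>|d|\<^sup>2\<close>.\<close>
lemma lyapunov_equivalent_norm:
  assumes A: "A \<in> carrier_mat m n" and d: "d \<in> carrier_vec n" and e: "e \<in> carrier_vec m"
    and bound: "(A *\<^sub>v d) \<bullet> (A *\<^sub>v d) \<le> k * (d \<bullet> d)"
    and "0 < \<eta>" "0 < c" and c: "16 * \<eta> * k \<le> c\<^sup>2"
  shows "\<bar>lyapunov \<eta> c A d e - c * (\<eta> * (d \<bullet> d) + e \<bullet> e)\<bar> \<le> c / 4 * (\<eta> * (d \<bullet> d) + e \<bullet> e)"
proof -
  let ?p = "(A *\<^sub>v d) \<bullet> e"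
  have Ad: "A *\<^sub>v d \<in> carrier_vec m" using A d by simp
  have dd: "0 \<le> d \<bullet> d" by (rule scalar_prod_self_nonneg)
  have young: "2 * s * ?p \<le> k * (d \<bullet> d) + s\<^sup>2 * (e \<bullet> e)" for s
    using two_scalar_prod_le[OF Ad e, of s] bound by linarith
  have cross: "2 * \<eta> * (\<sigma> * ?p) \<le> c / 4 * (\<eta> * (d \<bullet> d) + e \<bullet> e)" if \<sigma>: "\<sigma>\<^sup>2 = 1" for \<sigma>
  proof -
    have "4 * \<eta>\<^sup>2 / c * (2 * (\<sigma> * (c / (4 * \<eta>))) * ?p)
        \<le> 4 * \<eta>\<^sup>2 / c * (k * (d \<bullet> d) + (\<sigma> * (c / (4 * \<eta>)))\<^sup>2 * (e \<bullet> e))"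
      using \<open>0 < c\<close> by (intro mult_left_mono young) simp
    also have "\<dots> = 4 * \<eta>\<^sup>2 * k / c * (d \<bullet> d) + c / 4 * (e \<bullet> e)"
      using \<open>0 < c\<close> \<open>0 < \<eta>\<close> \<sigma> by (simp add: power_mult_distrib field_simps power2_eq_square)
    also have "4 * \<eta>\<^sup>2 / c * (2 * (\<sigma> * (c / (4 * \<eta>))) * ?p) = 2 * \<eta> * (\<sigma> * ?p)"
      using \<open>0 < c\<close> \<open>0 < \<eta>\<close> by (simp add: power2_eq_square)
    finally have "2 * \<eta> * (\<sigma> * ?p) \<le> 4 * \<eta>\<^sup>2 * k / c * (d \<bullet> d) + c / 4 * (e \<bullet> e)" .
    moreover have "4 * \<eta>\<^sup>2 * k / c \<le> \<eta> * c / 4"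
      using mult_left_mono[OF c, of \<eta>] \<open>0 < c\<close> \<open>0 < \<eta>\<close> by (simp add: field_simps power2_eq_square)
    then have "4 * \<eta>\<^sup>2 * k / c * (d \<bullet> d) \<le> \<eta> * c / 4 * (d \<bullet> d)"
      using dd by (rule mult_right_mono)
    moreover have "c / 4 * (\<eta> * (d \<bullet> d) + e \<bullet> e) = \<eta> * c / 4 * (d \<bullet> d) + c / 4 * (e \<bullet> e)"
      by (simp add: algebra_simps)
    ultimately show ?thesis by linarith
  qed
  have "lyapunov \<eta> c A d e - c * (\<eta> * (d \<bullet> d) + e \<bullet> e) = 2 * \<eta> * ?p"
    using comm_scalar_prod[OF e Ad] by (simp add: lyapunov_def algebra_simps)
  then show ?thesis using cross[of 1] cross[of "-1"] by simp
qed

lemma lyapunov_has_derivative: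
  assumes d: "curve_has_derivative n d d' t" and e: "curve_has_derivative m e e' t"
    and cd: "\<And>s. 0 \<le> s \<Longrightarrow> d s \<in> carrier_vec n" and ce: "\<And>s. 0 \<le> s \<Longrightarrow> e s \<in> carrier_vec m"
    and "0 \<le> t" and A: "A \<in> carrier_mat m n"
  shows "((\<lambda>s. lyapunov \<eta> c A (d s) (e s)) has_real_derivative
    2 * \<eta> * c * (d t \<bullet> d') + 2 * \<eta> * (e' \<bullet> (A *\<^sub>v d t) + e t \<bullet> (A *\<^sub>v d')) + 2 * c * (e t \<bullet> e'))
    (at t within {0..})"
proof -
  have "d' \<in> carrier_vec n" "e' \<in> carrier_vec m"
    using d e by (auto simp: curve_has_derivative_def)
  then have "d' \<bullet> d t = d t \<bullet> d'" "e' \<bullet> e t = e t \<bullet> e'"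
    using cd ce \<open>0 \<le> t\<close> comm_scalar_prod by metis+
  moreover have "A *\<^sub>v d s \<in> carrier_vec m" if "0 \<le> s" for s using A cd[OF that] by simp
  ultimately show ?thesis
    unfolding lyapunov_def
    using has_derivative_scalar_prod[OF d d cd cd \<open>0 \<le> t\<close>]
      has_derivative_scalar_prod[OF e e ce ce \<open>0 \<le> t\<close>]
      has_derivative_scalar_prod[OF e curve_has_derivative_mult_mat_vec[OF d cd \<open>0 \<le> t\<close> A] ce _ \<open>0 \<le> t\<close>]
    by (auto intro!: derivative_eq_intros simp: algebra_simps)
qed

text \<open>Along the dynamics the left-hand side is, with \<open>w = A\<^sup>T e\<close>,
  \<open>\<eta> (2 \<eta> |A d|\<^sup>2 - 2 c (g \<bullet> d) - 2 (g \<bullet> w) - 2 |w|\<^sup>2) + \<tau> (\<eta> c |d|\<^sup>2 + 2 \<eta> (w \<bullet> d) + c |e|\<^sup>2)\<close>.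
  One copy of \<open>\<eta> |w|\<^sup>2\<close> pays for \<open>\<tau> c |e|\<^sup>2\<close>, the other for the terms linear in \<open>w\<close>, at the price
  of \<open>|g - \<tau> d|\<^sup>2\<close>.  The remainder involves \<open>d\<close> and \<open>g\<close> only: \<open>|g|\<^sup>2\<close>, \<open>2 \<eta> |A d|\<^sup>2\<close> and
  \<open>\<tau> c |d|\<^sup>2\<close> cost at most \<open>c / 4\<close>, \<open>c / 2\<close> and \<open>c / 4\<close> times \<open>g \<bullet> d\<close>, while \<open>2 c (g \<bullet> d)\<close> is
  available.  The cross product in the square contributes \<open>- 2 \<tau> (g \<bullet> d)\<close>, which covers
  \<open>\<tau>\<^sup>2 |d|\<^sup>2\<close>.\<close>
lemma lyapunov_dissipation:
  fixes \<eta> \<kappa>\<^sub>1 \<kappa>\<^sub>2 \<mu> l :: real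
  defines "\<tau> \<equiv> tau_eq \<eta> \<kappa>\<^sub>1 \<kappa>\<^sub>2 \<mu> l" and "c \<equiv> lyapunov_weight \<eta> \<kappa>\<^sub>1 \<kappa>\<^sub>2 \<mu> l"
  assumes pos: "0 < \<eta>" "0 < \<kappa>\<^sub>1" "0 < \<kappa>\<^sub>2" "0 < \<mu>" "0 < l" and \<kappa>: "\<kappa>\<^sub>1 \<le> \<kappa>\<^sub>2"
    and A: "A \<in> carrier_mat m n"
    and d: "d \<in> carrier_vec n" and e: "e \<in> carrier_vec m" and g: "g \<in> carrier_vec n"
    and strong: "\<mu> * (d \<bullet> d) \<le> g \<bullet> d" and coco: "g \<bullet> g \<le> l * (g \<bullet> d)"
    and lower: "\<kappa>\<^sub>1 * (e \<bullet> e) \<le> (A\<^sup>T *\<^sub>v e) \<bullet> (A\<^sup>T *\<^sub>v e)"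
    and upper: "(A *\<^sub>v d) \<bullet> (A *\<^sub>v d) \<le> \<kappa>\<^sub>2 * (d \<bullet> d)"
    and d': "d' = - g - A\<^sup>T *\<^sub>v e" and e': "e' = \<eta> \<cdot>\<^sub>v (A *\<^sub>v d)"
  shows "2 * \<eta> * c * (d \<bullet> d') + 2 * \<eta> * (e' \<bullet> (A *\<^sub>v d) + e \<bullet> (A *\<^sub>v d')) + 2 * c * (e \<bullet> e')
    + \<tau> * lyapunov \<eta> c A d e \<le> 0"
proof -
  define w where "w = A\<^sup>T *\<^sub>v e"
  have w: "w \<in> carrier_vec n" and Ad: "A *\<^sub>v d \<in> carrier_vec m" and d'c: "d' \<in> carrier_vec n"
    using A d e g by (auto simp: w_def d')
  have adj: "e \<bullet> (A *\<^sub>v v) = w \<bullet> v" if "v \<in> carrier_vec n" for v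
    using transpose_vec_mult_scalar[OF A that e] comm_scalar_prod[of e m "A *\<^sub>v v"] A e that
      comm_scalar_prod[of w n v] w
    by (simp add: w_def)
  have left: "u \<bullet> d' = - (g \<bullet> u) - w \<bullet> u" if "u \<in> carrier_vec n" for u
    using that g w comm_scalar_prod[of u n g] comm_scalar_prod[of u n w]
    by (simp add: d' w_def[symmetric] scalar_prod_minus_distrib[where n = n])
  define dd gd gg gw wd ww ee aa where
    "dd = d \<bullet> d" and "gd = g \<bullet> d" and "gg = g \<bullet> g" and "gw = g \<bullet> w" and "wd = w \<bullet> d"
    and "ww = w \<bullet> w" and "ee = e \<bullet> e" and "aa = (A *\<^sub>v d) \<bullet> (A *\<^sub>v d)"
  note names = dd_def gd_def gg_def gw_def wd_def ww_def ee_def aa_def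

  have rate: "2 * \<eta> * c * (d \<bullet> d') + 2 * \<eta> * (e' \<bullet> (A *\<^sub>v d) + e \<bullet> (A *\<^sub>v d')) + 2 * c * (e \<bullet> e')
      = \<eta> * (2 * \<eta> * aa - 2 * c * gd - 2 * gw - 2 * ww)"
    using d e w Ad by (simp add: e' adj left d'c names algebra_simps)
  have V: "lyapunov \<eta> c A d e = \<eta> * c * dd + 2 * \<eta> * wd + c * ee"
    using d by (simp add: lyapunov_def adj names)

  have \<tau>: "0 < \<tau>" using tau_eq_pos[OF pos] by (simp add: \<tau>_def)
  have \<tau>c: "\<tau> * c = \<eta> * \<kappa>\<^sub>1"
    using \<tau> by (simp add: c_def \<tau>_def lyapunov_weight_def)
  have cl: "4 * l \<le> c" and c\<mu>: "4 * \<eta> * \<kappa>\<^sub>2 \<le> c * \<mu>"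
    using lyapunov_weight_bounds[OF pos] by (simp_all add: c_def)
  have dd: "0 \<le> dd" by (simp add: names scalar_prod_self_nonneg)
  then have "0 \<le> \<mu> * dd" using pos by simp
  then have gd: "0 \<le> gd" using strong by (simp add: names)

  have "(w + g) \<bullet> (w + g) = ww + 2 * gw + gg" "(w + g) \<bullet> d = wd + gd"
    using w g d comm_scalar_prod[OF w g]
    by (simp_all add: names add_scalar_prod_distrib[where n = n] scalar_prod_add_distrib[where n = n])
  \<comment> \<open>The square being completed is \<open>|w + g - \<tau> d|\<^sup>2\<close>.\<close>
  then have square: "2 * \<tau> * (wd + gd) \<le> ww + 2 * gw + gg + \<tau>\<^sup>2 * dd"
    using two_scalar_prod_le[of "w + g" n d \<tau>] w g d by (simp add: names)
  have "l * gd \<le> c / 4 * gd" using cl gd by (intro mult_right_mono) auto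
  then have i1: "gg \<le> c / 4 * gd" using coco by (simp add: names)
  have "\<eta> * \<kappa>\<^sub>2 * dd \<le> c * \<mu> / 4 * dd" using c\<mu> dd by (intro mult_right_mono) auto
  also have "\<dots> = c / 4 * (\<mu> * dd)" by simp
  also have "\<dots> \<le> c / 4 * gd" using strong cl pos by (intro mult_left_mono) (auto simp: names)
  finally have \<kappa>2: "\<eta> * \<kappa>\<^sub>2 * dd \<le> c / 4 * gd" .
  have "\<eta> * aa \<le> \<eta> * (\<kappa>\<^sub>2 * dd)"
    using upper pos by (intro mult_left_mono) (simp_all add: names)
  then have i2: "\<eta> * aa \<le> c / 4 * gd" using \<kappa>2 by (simp add: mult.assoc)
  have "\<eta> * \<kappa>\<^sub>1 * dd \<le> \<eta> * \<kappa>\<^sub>2 * dd" using \<kappa> pos dd by (intro mult_right_mono) auto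
  then have i3: "\<tau> * c * dd \<le> c / 4 * gd" using \<kappa>2 by (simp add: \<tau>c)
  have "\<tau> \<le> \<kappa>\<^sub>1 * \<mu> / (4 * \<kappa>\<^sub>2)" by (simp add: \<tau>_def tau_eq_def)
  also have "\<dots> \<le> \<mu> / 4" using \<kappa> pos by (simp add: field_simps)
  also have "\<dots> \<le> \<mu>" using pos by simp
  finally have "\<tau> * dd \<le> \<mu> * dd" using dd by (rule mult_right_mono)
  also have "\<dots> \<le> gd" using strong by (simp add: names)
  finally have i4: "\<tau>\<^sup>2 * dd \<le> \<tau> * gd" using \<tau> by (simp add: power2_eq_square mult.assoc)
  have "0 \<le> \<tau> * gd" "0 \<le> c * gd" using \<tau> gd cl pos by simp_all
  then have "2 * \<eta> * aa - 2 * c * gd - 2 * gw - ww + \<tau> * c * dd + 2 * \<tau> * wd \<le> 0"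
    using square i1 i2 i3 i4 by (simp add: algebra_simps)
  then have "\<eta> * (2 * \<eta> * aa - 2 * c * gd - 2 * gw - ww + \<tau> * c * dd + 2 * \<tau> * wd) \<le> 0"
    using pos by (simp add: mult_le_0_iff)
  moreover have "\<tau> * c * ee \<le> \<eta> * ww"
    using mult_left_mono[OF lower, of \<eta>] pos by (simp add: \<tau>c names w_def mult.assoc)
  ultimately show ?thesis unfolding rate V by (simp add: algebra_simps)
qed

section \<open>Exponential convergence of the primal-dual dynamics\<close>

text \<open>Both bounds are tested on a unit vector, which exists since \<open>m \<ge> 1\<close>.\<close>
lemma gram_bounds_ordered:
  assumes A: "A \<in> carrier_mat m n" and "1 \<le> m"
    and "loewner_le m (k\<^sub>1 \<cdot>\<^sub>m 1\<^sub>m m) (A * A\<^sup>T)" and "loewner_le m (A * A\<^sup>T) (k\<^sub>2 \<cdot>\<^sub>m 1\<^sub>m m)"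
  shows "k\<^sub>1 \<le> k\<^sub>2"
proof -
  have "(unit_vec m 0 :: real vec) \<bullet> unit_vec m 0 = 1" using \<open>1 \<le> m\<close> by simp
  then show ?thesis
    using gram_lower_bound[OF A assms(3), of "unit_vec m 0"]
      gram_upper_bound[OF A assms(4), of "unit_vec m 0"] by simp
qed

text \<open>Tested on a unit vector and \<open>0\<close>; for \<open>n = 0\<close> the two bounds would not relate \<open>\<mu>\<close> to \<open>l\<close>.  The
  inequality makes the weight \<open>c\<close> large enough to dominate the cross term.\<close>
lemma modulus_le:
  assumes "1 \<le> n"
    and strong: "\<And>y z. y \<in> carrier_vec n \<Longrightarrow> z \<in> carrier_vec n \<Longrightarrow>
      \<mu> * (vnorm (y - z))\<^sup>2 \<le> (gradient n f y - gradient n f z) \<bullet> (y - z)"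
    and upper: "\<And>y z. y \<in> carrier_vec n \<Longrightarrow> z \<in> carrier_vec n \<Longrightarrow>
      (gradient n f y - gradient n f z) \<bullet> (y - z) \<le> l * (vnorm (y - z))\<^sup>2"
  shows "\<mu> \<le> l"
proof -
  have "unit_vec n 0 - 0\<^sub>v n = (unit_vec n 0 :: real vec)" by (intro eq_vecI) auto
  then have "(vnorm (unit_vec n 0 - 0\<^sub>v n))\<^sup>2 = 1"
    using \<open>1 \<le> n\<close> by (simp add: power2_vnorm)
  then show ?thesis
    using order_trans[OF strong upper, of "unit_vec n 0" "0\<^sub>v n"] by simp
qed

lemma fields_relative_to_equilibrium:
  assumes A: "A \<in> carrier_mat m n" and b: "b \<in> carrier_vec m" and "0 < \<eta>"
    and x: "x \<in> carrier_vec n" and lam: "lam \<in> carrier_vec m"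
    and gx: "gradient n f x \<in> carrier_vec n" and gxs: "gradient n f xs \<in> carrier_vec n"
    and eq: "is_equilibrium n m f A b \<eta> xs ls"
  shows "primal_field n f A x lam = - (gradient n f x - gradient n f xs) - A\<^sup>T *\<^sub>v (lam - ls)"
    and "dual_field \<eta> A b x = \<eta> \<cdot>\<^sub>v (A *\<^sub>v (x - xs))"
proof -
  have c: "xs \<in> carrier_vec n" "ls \<in> carrier_vec m"
    and p: "- gradient n f xs - A\<^sup>T *\<^sub>v ls = 0\<^sub>v n" and q: "\<eta> \<cdot>\<^sub>v (A *\<^sub>v xs - b) = 0\<^sub>v m"
    using eq by (auto simp: is_equilibrium_def primal_field_def dual_field_def)
  have AT: "A\<^sup>T \<in> carrier_mat n m" using A by simp
  have pi: "gradient n f xs $ i = - (A\<^sup>T *\<^sub>v ls) $ i" if "i < n" for i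
    using arg_cong[OF p, of "\<lambda>v. v $ i"] that AT gxs c by simp
  have qi: "b $ i = (A *\<^sub>v xs) $ i" if "i < m" for i
    using arg_cong[OF q, of "\<lambda>v. v $ i"] that A b c \<open>0 < \<eta>\<close> by simp
  show "primal_field n f A x lam = - (gradient n f x - gradient n f xs) - A\<^sup>T *\<^sub>v (lam - ls)"
    unfolding primal_field_def mult_minus_distrib_mat_vec[OF AT lam c(2)]
    using AT gx gxs pi by (intro eq_vecI) (auto simp del: index_mult_mat_vec)
  show "dual_field \<eta> A b x = \<eta> \<cdot>\<^sub>v (A *\<^sub>v (x - xs))"
    unfolding dual_field_def mult_minus_distrib_mat_vec[OF A x c(1)]
    using A b qi by (intro eq_vecI) (auto simp del: index_mult_mat_vec)
qed

text \<open>The weight \<open>c\<close> drops out, since it multiplies both sides of the comparison between the Lyapunov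
  function and the weighted error.\<close>
lemma weighted_error_decay:
  assumes "1 \<le> n" and "1 \<le> m" and A: "A \<in> carrier_mat m n" and b: "b \<in> carrier_vec m"
    and diff: "\<And>y. y \<in> carrier_vec n \<Longrightarrow> differentiable_vec n f y"
    and pos: "0 < \<eta>" "0 < \<kappa>\<^sub>1" "0 < \<kappa>\<^sub>2" "0 < \<mu>" "0 < l"
    and strong: "\<And>y z. y \<in> carrier_vec n \<Longrightarrow> z \<in> carrier_vec n \<Longrightarrow>
      \<mu> * (vnorm (y - z))\<^sup>2 \<le> (gradient n f y - gradient n f z) \<bullet> (y - z)"
    and upper: "\<And>y z. y \<in> carrier_vec n \<Longrightarrow> z \<in> carrier_vec n \<Longrightarrow>
      (gradient n f y - gradient n f z) \<bullet> (y - z) \<le> l * (vnorm (y - z))\<^sup>2"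
    and k1: "loewner_le m (\<kappa>\<^sub>1 \<cdot>\<^sub>m 1\<^sub>m m) (A * A\<^sup>T)"
    and k2: "loewner_le m (A * A\<^sup>T) (\<kappa>\<^sub>2 \<cdot>\<^sub>m 1\<^sub>m m)"
    and eq: "is_equilibrium n m f A b \<eta> xs ls"
    and sol: "is_solution n m f A b \<eta> x lam" and "0 \<le> t"
  shows "\<eta> * (vnorm (x t - xs))\<^sup>2 + (vnorm (lam t - ls))\<^sup>2
    \<le> 5 / 3 * (\<eta> * (vnorm (x 0 - xs))\<^sup>2 + (vnorm (lam 0 - ls))\<^sup>2)
      * exp (- tau_eq \<eta> \<kappa>\<^sub>1 \<kappa>\<^sub>2 \<mu> l * t)"
proof -
  define c where "c = lyapunov_weight \<eta> \<kappa>\<^sub>1 \<kappa>\<^sub>2 \<mu> l"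
  define \<tau> where "\<tau> = tau_eq \<eta> \<kappa>\<^sub>1 \<kappa>\<^sub>2 \<mu> l"
  define d where "d s = x s - xs" for s
  define e where "e s = lam s - ls" for s
  define E where "E s = \<eta> * (d s \<bullet> d s) + e s \<bullet> e s" for s
  define V where "V s = lyapunov \<eta> c A (d s) (e s)" for s
  have eqc: "xs \<in> carrier_vec n" "ls \<in> carrier_vec m"
    using eq by (auto simp: is_equilibrium_def)
  have xc: "x s \<in> carrier_vec n" and lc: "lam s \<in> carrier_vec m"
    and dx: "curve_has_derivative n x (primal_field n f A (x s) (lam s)) s"
    and dl: "curve_has_derivative m lam (dual_field \<eta> A b (x s)) s" if "0 \<le> s" for s
    using sol that by (auto simp: is_solution_def)
  have dc: "d s \<in> carrier_vec n" and ec: "e s \<in> carrier_vec m" if "0 \<le> s" for s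
    using xc[OF that] lc[OF that] eqc by (auto simp: d_def e_def)
  have \<kappa>: "\<kappa>\<^sub>1 \<le> \<kappa>\<^sub>2" using gram_bounds_ordered[OF A \<open>1 \<le> m\<close> k1 k2] .
  have mono: "0 \<le> (gradient n f y - gradient n f z) \<bullet> (y - z)"
    if "y \<in> carrier_vec n" "z \<in> carrier_vec n" for y z
    using order_trans[OF _ strong[OF that]] pos by simp

  let ?g = "\<lambda>s. gradient n f (x s) - gradient n f xs"
  let ?d' = "\<lambda>s. - ?g s - A\<^sup>T *\<^sub>v e s"
  let ?e' = "\<lambda>s. \<eta> \<cdot>\<^sub>v (A *\<^sub>v d s)"
  let ?V' = "\<lambda>s. 2 * \<eta> * c * (d s \<bullet> ?d' s)
      + 2 * \<eta> * (?e' s \<bullet> (A *\<^sub>v d s) + e s \<bullet> (A *\<^sub>v ?d' s)) + 2 * c * (e s \<bullet> ?e' s)"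
  have "V t \<le> V 0 * exp (- \<tau> * t)"
  proof (rule exponential_decay[where V' = ?V', OF _ _ \<open>0 \<le> t\<close>])
    fix s :: real assume s: "0 \<le> s"
    have gc: "gradient n f (x s) \<in> carrier_vec n" "gradient n f xs \<in> carrier_vec n"
      using gradient_carrier diff xc[OF s] eqc by auto
    note fields = fields_relative_to_equilibrium[OF A b pos(1) xc[OF s] lc[OF s] gc eq]
    have "curve_has_derivative n d (?d' s) s"
      unfolding d_def e_def using curve_has_derivative_diff_const[OF dx[OF s] eqc(1)] fields by simp
    moreover have "curve_has_derivative m e (?e' s) s"
      unfolding d_def e_def using curve_has_derivative_diff_const[OF dl[OF s] eqc(2)] fields by simp
    ultimately show "(V has_real_derivative ?V' s) (at s within {0..})"
      unfolding V_def by (rule lyapunov_has_derivative[OF _ _ dc ec s A])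
    show "?V' s + \<tau> * V s \<le> 0"
      unfolding V_def \<tau>_def c_def
    proof (rule lyapunov_dissipation[OF pos \<kappa> A dc[OF s] ec[OF s] _ _ _ _ _ refl refl])
      show "?g s \<in> carrier_vec n" using gc by simp
      show "\<mu> * (d s \<bullet> d s) \<le> ?g s \<bullet> d s"
        using strong[OF xc[OF s] eqc(1)] by (simp add: power2_vnorm d_def)
      show "?g s \<bullet> ?g s \<le> l * (?g s \<bullet> d s)"
        using gradient_cocoercive[OF diff mono upper pos(5) xc[OF s] eqc(1)]
        by (simp add: power2_vnorm d_def)
      show "\<kappa>\<^sub>1 * (e s \<bullet> e s) \<le> (A\<^sup>T *\<^sub>v e s) \<bullet> (A\<^sup>T *\<^sub>v e s)"
        using gram_lower_bound[OF A k1 ec[OF s]] .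
      show "(A *\<^sub>v d s) \<bullet> (A *\<^sub>v d s) \<le> \<kappa>\<^sub>2 * (d s \<bullet> d s)"
        using image_norm_bound[OF A k2 pos(3) dc[OF s]] .
    qed
  qed

  have cl: "4 * l \<le> c" and c\<mu>: "4 * \<eta> * \<kappa>\<^sub>2 \<le> c * \<mu>"
    using lyapunov_weight_bounds[OF pos] by (simp_all add: c_def)
  have c: "0 < c" using cl pos by linarith
  have bounds: "3 / 4 * (c * E s) \<le> V s" "V s \<le> 5 / 4 * (c * E s)" if "0 \<le> s" for s
  proof -
    have "4 * \<mu> \<le> c" using modulus_le[OF \<open>1 \<le> n\<close> strong upper] cl by linarith
    then have "c * (4 * \<mu>) \<le> c * c" using c by (intro mult_left_mono) auto
    then have "16 * \<eta> * \<kappa>\<^sub>2 \<le> c\<^sup>2" using c\<mu> by (simp add: power2_eq_square)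
    then have "\<bar>V s - c * E s\<bar> \<le> c / 4 * E s"
      unfolding V_def E_def
      using lyapunov_equivalent_norm[OF A dc[OF that] ec[OF that]
          image_norm_bound[OF A k2 pos(3) dc[OF that]] pos(1) c] by blast
    then show "3 / 4 * (c * E s) \<le> V s" "V s \<le> 5 / 4 * (c * E s)"
      unfolding abs_le_iff by linarith+
  qed
  have "3 / 4 * (c * E t) \<le> V t" using bounds \<open>0 \<le> t\<close> by simp
  also have "\<dots> \<le> V 0 * exp (- \<tau> * t)" by fact
  also have "\<dots> \<le> 5 / 4 * (c * E 0) * exp (- \<tau> * t)"
    using bounds[of 0] by (intro mult_right_mono) auto
  finally have "c * (3 * E t) \<le> c * (5 * E 0 * exp (- \<tau> * t))" by (simp add: algebra_simps)
  then have "E t \<le> 5 / 3 * E 0 * exp (- \<tau> * t)" using c by simp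
  then show ?thesis by (simp add: E_def d_def e_def power2_vnorm \<tau>_def)
qed

theorem theorem1:
  shows "\<exists>(C\<^sub>1 :: real \<Rightarrow> real \<Rightarrow> real \<Rightarrow> real \<Rightarrow> real \<Rightarrow> real \<Rightarrow> real \<Rightarrow> real)
          (C\<^sub>2 :: real \<Rightarrow> real \<Rightarrow> real \<Rightarrow> real \<Rightarrow> real \<Rightarrow> real \<Rightarrow> real \<Rightarrow> real).
    \<forall>(n::nat) (m::nat) (A :: real mat) (b :: real vec) (f :: real vec \<Rightarrow> real)
      (\<mu>::real) (l::real) (\<kappa>\<^sub>1::real) (\<kappa>\<^sub>2::real) (\<eta>::real)
      (xs :: real vec) (ls :: real vec) (x :: real \<Rightarrow> real vec) (lam :: real \<Rightarrow> real vec).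
      n \<ge> 1 \<longrightarrow> m \<ge> 1 \<longrightarrow>
      A \<in> carrier_mat m n \<longrightarrow> b \<in> carrier_vec m \<longrightarrow>
      twice_differentiable n f \<longrightarrow>
      \<mu> > 0 \<longrightarrow> l > 0 \<longrightarrow>
      (\<forall>y\<in>carrier_vec n. \<forall>z\<in>carrier_vec n.
         \<mu> * (vnorm (y - z))\<^sup>2 \<le> (gradient n f y - gradient n f z) \<bullet> (y - z) \<and>
         (gradient n f y - gradient n f z) \<bullet> (y - z) \<le> l * (vnorm (y - z))\<^sup>2) \<longrightarrow>
      full_row_rank m A \<longrightarrow>
      \<kappa>\<^sub>1 > 0 \<longrightarrow> \<kappa>\<^sub>2 > 0 \<longrightarrow>
      loewner_le m (\<kappa>\<^sub>1 \<cdot>\<^sub>m 1\<^sub>m m) (A * A\<^sup>T) \<longrightarrow>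
      loewner_le m (A * A\<^sup>T) (\<kappa>\<^sub>2 \<cdot>\<^sub>m 1\<^sub>m m) \<longrightarrow>
      \<eta> > 0 \<longrightarrow>
      is_equilibrium n m f A b \<eta> xs ls \<longrightarrow>
      is_solution n m f A b \<eta> x lam \<longrightarrow>
      (\<forall>t\<ge>0.
         vnorm (x t - xs)
           \<le> C\<^sub>1 \<eta> \<kappa>\<^sub>1 \<kappa>\<^sub>2 \<mu> l (vnorm (x 0 - xs)) (vnorm (lam 0 - ls))
               * exp (- (1 / 2) * tau_eq \<eta> \<kappa>\<^sub>1 \<kappa>\<^sub>2 \<mu> l * t) \<and>
         vnorm (lam t - ls)
           \<le> C\<^sub>2 \<eta> \<kappa>\<^sub>1 \<kappa>\<^sub>2 \<mu> l (vnorm (x 0 - xs)) (vnorm (lam 0 - ls))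
               * exp (- (1 / 2) * tau_eq \<eta> \<kappa>\<^sub>1 \<kappa>\<^sub>2 \<mu> l * t))"
proof -
  define C\<^sub>1 :: "real \<Rightarrow> real \<Rightarrow> real \<Rightarrow> real \<Rightarrow> real \<Rightarrow> real \<Rightarrow> real \<Rightarrow> real"
    where "C\<^sub>1 \<eta> \<kappa>\<^sub>1 \<kappa>\<^sub>2 \<mu> l p q = sqrt (5 / 3 * (\<eta> * p\<^sup>2 + q\<^sup>2) / \<eta>)" for \<eta> \<kappa>\<^sub>1 \<kappa>\<^sub>2 \<mu> l p q
  define C\<^sub>2 :: "real \<Rightarrow> real \<Rightarrow> real \<Rightarrow> real \<Rightarrow> real \<Rightarrow> real \<Rightarrow> real \<Rightarrow> real"
    where "C\<^sub>2 \<eta> \<kappa>\<^sub>1 \<kappa>\<^sub>2 \<mu> l p q = sqrt (5 / 3 * (\<eta> * p\<^sup>2 + q\<^sup>2))" for \<eta> \<kappa>\<^sub>1 \<kappa>\<^sub>2 \<mu> l p q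
  have root: "a \<le> sqrt K * exp (- (1 / 2) * \<tau> * t)" if "a\<^sup>2 \<le> K * exp (- \<tau> * t)" for a K \<tau> t :: real
  proof -
    have "exp (- \<tau> * t) = (exp (- (1 / 2) * \<tau> * t))\<^sup>2"
      by (simp add: exp_double[symmetric])
    then have "sqrt (K * exp (- \<tau> * t)) = sqrt K * exp (- (1 / 2) * \<tau> * t)"
      by (simp add: real_sqrt_mult)
    then show ?thesis using real_le_rsqrt[OF that] by simp
  qed
  show ?thesis
  proof (rule exI[of _ C\<^sub>1], rule exI[of _ C\<^sub>2], intro allI impI)
    fix n m :: nat and A :: "real mat" and b :: "real vec" and f :: "real vec \<Rightarrow> real"
      and \<mu> l \<kappa>\<^sub>1 \<kappa>\<^sub>2 \<eta> :: real and xs ls :: "real vec" and x lam :: "real \<Rightarrow> real vec" and t :: real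
    assume dims: "n \<ge> 1" "m \<ge> 1" "A \<in> carrier_mat m n" "b \<in> carrier_vec m"
      and f: "twice_differentiable n f" and \<mu>l: "\<mu> > 0" "l > 0"
      and grad: "\<forall>y\<in>carrier_vec n. \<forall>z\<in>carrier_vec n.
         \<mu> * (vnorm (y - z))\<^sup>2 \<le> (gradient n f y - gradient n f z) \<bullet> (y - z) \<and>
         (gradient n f y - gradient n f z) \<bullet> (y - z) \<le> l * (vnorm (y - z))\<^sup>2"
      and \<kappa>: "\<kappa>\<^sub>1 > 0" "\<kappa>\<^sub>2 > 0" "loewner_le m (\<kappa>\<^sub>1 \<cdot>\<^sub>m 1\<^sub>m m) (A * A\<^sup>T)"
        "loewner_le m (A * A\<^sup>T) (\<kappa>\<^sub>2 \<cdot>\<^sub>m 1\<^sub>m m)"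
      and \<eta>: "\<eta> > 0" and eq: "is_equilibrium n m f A b \<eta> xs ls"
      and sol: "is_solution n m f A b \<eta> x lam" and t: "0 \<le> t"
    let ?p = "vnorm (x 0 - xs)" and ?q = "vnorm (lam 0 - ls)"
    let ?K = "5 / 3 * (\<eta> * ?p\<^sup>2 + ?q\<^sup>2)" and ?\<tau> = "tau_eq \<eta> \<kappa>\<^sub>1 \<kappa>\<^sub>2 \<mu> l"
    have decay: "\<eta> * (vnorm (x t - xs))\<^sup>2 + (vnorm (lam t - ls))\<^sup>2 \<le> ?K * exp (- ?\<tau> * t)"
    proof (rule weighted_error_decay[OF dims _ \<eta> \<kappa>(1,2) \<mu>l _ _ \<kappa>(3,4) eq sol t])
      show "differentiable_vec n f y" if "y \<in> carrier_vec n" for y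
        using f that by (simp add: twice_differentiable_def)
    qed (use grad in auto)
    moreover have "0 \<le> (vnorm (lam t - ls))\<^sup>2" by simp
    ultimately have "\<eta> * (vnorm (x t - xs))\<^sup>2 \<le> ?K * exp (- ?\<tau> * t)" by linarith
    then have "(vnorm (x t - xs))\<^sup>2 \<le> ?K / \<eta> * exp (- ?\<tau> * t)"
      using \<eta> by (simp add: field_simps)
    moreover have "0 \<le> \<eta> * (vnorm (x t - xs))\<^sup>2" using \<eta> by simp
    then have "(vnorm (lam t - ls))\<^sup>2 \<le> ?K * exp (- ?\<tau> * t)" using decay by linarith
    ultimately show "vnorm (x t - xs) \<le> C\<^sub>1 \<eta> \<kappa>\<^sub>1 \<kappa>\<^sub>2 \<mu> l ?p ?q * exp (- (1 / 2) * ?\<tau> * t) \<and>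
        vnorm (lam t - ls) \<le> C\<^sub>2 \<eta> \<kappa>\<^sub>1 \<kappa>\<^sub>2 \<mu> l ?p ?q * exp (- (1 / 2) * ?\<tau> * t)"
      unfolding C\<^sub>1_def C\<^sub>2_def by (intro conjI root)
  qed
qed

end
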